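(* Let $n\ge 2$, let $Q\subset\mathbb{R}^n$ be a finite set with at least two points, and let $X=\mathbb{R}^n-Q$ with the Euclidean metric. Then $\mathrm{GC}(X)=\mathrm{TC}(X)=2$.
   Context: Let $I=[0,1]$. For a topological space $Z$, $P(Z)=Z^I$ is the space of continuous maps $I\to Z$ with the compact-open topology, and $P(Z;z_0,z_1)$ is the subspace of paths from $z_0$ to $z_1$. The length of a path in a metric space is the supremum of the sums of distances between successive points on the path. A (minimal) geodesic from $x_0$ to $x_1$ in a metric space $(Z,d)$ is a path $\gamma$ from $x_0$ to $x_1$ with $d(\gamma(t),\gamma(t'))=|t-t'|\,d(x_0,x_1)$ for all $t,t'\in I$. A metric space is geodesic if every pair of its points is joined by a geodesic. Let $X$ be a metric space whose completion $\overline{X}$ is geodesic. For $x_0,x_1\in X$, a near-geodesic from $x_0$ to $x_1$ is a continuous map $\phi:I\to P(\overline{X};x_0,x_1)$ such that (i) $\phi(0)$ is a geodesic in $\overline{X}$ from $x_0$ to $x_1$; (ii) $\phi((0,1])\subset P(X;x_0,x_1)$; (iii) if $s_n\to 0$, then $\operatorname{length}(\phi(s_n))\to\operatorname{length}(\phi(0))$. For $E\subset X\times X$, a near-geodesic motion planning rule (NGMPR) on $E$ is a continuous map $\Phi:E\to P(\overline{X})^I$ such that, for all $(x_0,x_1)\in E$, $\Phi(x_0,x_1)$ is a near-geodesic from $x_0$ to $x_1$, with the additional proviso that $\Phi(x_0,x_1)(0)$ is a geodesic in $X$ if a geodesic in $X$ from $x_0$ to $x_1$ exists. The geodesic complexity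 $\mathrm{GC}(X)$ is the smallest $k$ such that $X\times X$ can be partitioned into locally compact sets $E_0,\ldots,E_k$ such that each $E_i$ has an NGMPR. The topological complexity $\mathrm{TC}(X)$ of a topological space $X$ (Farber, reduced version) is the smallest $k$ such that $X\times X$ can be partitioned into locally compact sets $E_0,\ldots,E_k$ on each of which there is a continuous map $s_i:E_i\to P(X)$ with $s_i(x_0,x_1)$ a path from $x_0$ to $x_1$ for all $(x_0,x_1)\in E_i$. *)

theory Defs
  imports "HOL-Analysis.Analysis"
begin

(* Continuous maps are represented by functions that are extensional outside the domain, so that
   equality of elements is equality of maps. Taking K empty shows that the topspace is the set of
   all such maps. *)
definition compact_open_topology :: "'a topology \<Rightarrow> 'b topology \<Rightarrow> ('a \<Rightarrow> 'b) topology" where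
  "compact_open_topology X Y = topology_generated_by
     {{f \<in> extensional (topspace X). continuous_map X Y f \<and> f ` K \<subseteq> U} | K U.
        compactin X K \<and> openin Y U}"

lemma topspace_compact_open_topology:
  "topspace (compact_open_topology X Y) = {f \<in> extensional (topspace X). continuous_map X Y f}"
proof -
  have "{f \<in> extensional (topspace X). continuous_map X Y f} \<in>
     {{f \<in> extensional (topspace X). continuous_map X Y f \<and> f ` K \<subseteq> U} | K U.
        compactin X K \<and> openin Y U}"
    by (rule CollectI, rule exI[of _ "{}"], rule exI[of _ "{}"]) auto
  then show ?thesis
    unfolding compact_open_topology_def by (auto simp: topology_generated_by_topspace)
qed

abbreviation unit_interval :: "real topology" where
  "unit_interval \<equiv> top_of_set {0..1}"

definition path_space :: "'a topology \<Rightarrow> (real \<Rightarrow> 'a) topology" where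
  "path_space Z = compact_open_topology unit_interval Z"

definition paths_between :: "'a topology \<Rightarrow> 'a \<Rightarrow> 'a \<Rightarrow> (real \<Rightarrow> 'a) set" where
  "paths_between Z x0 x1 = {\<gamma> \<in> topspace (path_space Z). \<gamma> 0 = x0 \<and> \<gamma> 1 = x1}"

(* The least k such that Z x Z is partitioned into locally compact sets E 0, ..., E k that all
   satisfy R; it is infinite if there is no such k. Empty parts do not affect the minimum. *)
definition partition_complexity :: "'a topology \<Rightarrow> (('a \<times> 'a) set \<Rightarrow> bool) \<Rightarrow> enat" where
  "partition_complexity Z R =
     (INF k \<in> {k. \<exists>E :: nat \<Rightarrow> ('a \<times> 'a) set.
                 disjoint_family_on E {..k} \<and>
                 (\<Union>i\<le>k. E i) = topspace Z \<times> topspace Z \<and>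
                 (\<forall>i\<le>k. locally_compact_space (subtopology (prod_topology Z Z) (E i)) \<and> R (E i))}.
        enat k)"

definition motion_planning_rule ::
  "'a topology \<Rightarrow> ('a \<times> 'a) set \<Rightarrow> ('a \<times> 'a \<Rightarrow> real \<Rightarrow> 'a) \<Rightarrow> bool" where
  "motion_planning_rule Z E s \<longleftrightarrow>
     continuous_map (subtopology (prod_topology Z Z) E) (path_space Z) s \<and>
     (\<forall>(x0, x1) \<in> E. s (x0, x1) \<in> paths_between Z x0 x1)"

definition TC :: "'a topology \<Rightarrow> enat" where
  "TC Z = partition_complexity Z (\<lambda>E. \<exists>s. motion_planning_rule Z E s)"

definition path_length :: "(real \<Rightarrow> 'a::metric_space) \<Rightarrow> ereal" where
  "path_length \<gamma> =
     (SUP (m, t) \<in> {(m :: nat, t :: nat \<Rightarrow> real). mono_on {..m} t \<and> t ` {..m} \<subseteq> {0..1}}.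
        ereal (\<Sum>i<m. dist (\<gamma> (t i)) (\<gamma> (t (Suc i)))))"

definition is_geodesic :: "'a::metric_space set \<Rightarrow> 'a \<Rightarrow> 'a \<Rightarrow> (real \<Rightarrow> 'a) \<Rightarrow> bool" where
  "is_geodesic Z x0 x1 \<gamma> \<longleftrightarrow>
     \<gamma> \<in> paths_between (top_of_set Z) x0 x1 \<and>
     (\<forall>t\<in>{0..1}. \<forall>t'\<in>{0..1}. dist (\<gamma> t) (\<gamma> t') = \<bar>t - t'\<bar> * dist x0 x1)"

definition geodesic_space :: "'a::metric_space set \<Rightarrow> bool" where
  "geodesic_space Z \<longleftrightarrow> (\<forall>x0\<in>Z. \<forall>x1\<in>Z. \<exists>\<gamma>. is_geodesic Z x0 x1 \<gamma>)"

(* From here on a metric space is a subset X of a complete metric space, which is no restriction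
   up to isometry, and its completion is closure X. The notions are meant for X such that
   geodesic_space (closure X) holds. *)

definition near_geodesic ::
  "'a::complete_space set \<Rightarrow> 'a \<Rightarrow> 'a \<Rightarrow> (real \<Rightarrow> real \<Rightarrow> 'a) \<Rightarrow> bool" where
  "near_geodesic X x0 x1 \<phi> \<longleftrightarrow>
     continuous_map unit_interval
       (subtopology (path_space (top_of_set (closure X)))
          (paths_between (top_of_set (closure X)) x0 x1)) \<phi> \<and>
     is_geodesic (closure X) x0 x1 (\<phi> 0) \<and>
     \<phi> ` {0<..1} \<subseteq> paths_between (top_of_set X) x0 x1 \<and>
     (\<forall>s. (\<forall>n. s n \<in> {0..1}) \<longrightarrow> s \<longlonglongrightarrow> 0 \<longrightarrow>
        (\<lambda>n. path_length (\<phi> (s n))) \<longlonglongrightarrow> path_length (\<phi> 0))"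

definition NGMPR ::
  "'a::complete_space set \<Rightarrow> ('a \<times> 'a) set \<Rightarrow> ('a \<times> 'a \<Rightarrow> real \<Rightarrow> real \<Rightarrow> 'a) \<Rightarrow> bool" where
  "NGMPR X E \<Phi> \<longleftrightarrow>
     continuous_map (subtopology (prod_topology (top_of_set X) (top_of_set X)) E)
       (compact_open_topology unit_interval (path_space (top_of_set (closure X)))) \<Phi> \<and>
     (\<forall>(x0, x1) \<in> E. near_geodesic X x0 x1 (\<Phi> (x0, x1)) \<and>
        ((\<exists>\<gamma>. is_geodesic X x0 x1 \<gamma>) \<longrightarrow> is_geodesic X x0 x1 (\<Phi> (x0, x1) 0)))"

definition GC :: "'a::complete_space set \<Rightarrow> enat" where
  "GC X = partition_complexity (top_of_set X) (\<lambda>E. \<exists>\<Phi>. NGMPR X E \<Phi>)"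

lemma geodesic_space_closure_cofinite:
  fixes Q :: "'a::euclidean_space set"
  assumes "finite Q"
  shows "geodesic_space (closure (UNIV - Q))"
proof -
  have cl: "closure (UNIV - Q) = UNIV"
    using empty_interior_finite[OF assms] closure_complement[of Q] by (simp add: Compl_eq_Diff_UNIV)
  have "is_geodesic UNIV x0 x1 (restrict (\<lambda>t. x0 + t *\<^sub>R (x1 - x0)) {0..1})" for x0 x1 :: 'a
  proof -
    have "dist (x0 + t *\<^sub>R (x1 - x0)) (x0 + t' *\<^sub>R (x1 - x0)) = \<bar>t - t'\<bar> * dist x0 x1" for t t' :: real
    proof -
      have "x0 + t *\<^sub>R (x1 - x0) - (x0 + t' *\<^sub>R (x1 - x0)) = (t - t') *\<^sub>R (x1 - x0)"
        by (simp add: algebra_simps)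
      then show ?thesis
        by (simp add: dist_norm norm_minus_commute)
    qed
    moreover have "continuous_on {0..1} (restrict (\<lambda>t. x0 + t *\<^sub>R (x1 - x0)) {0..1})"
      by (subst continuous_on_cong[OF refl restrict_apply']) (auto intro!: continuous_intros)
    ultimately show ?thesis
      by (auto simp: is_geodesic_def paths_between_def path_space_def topspace_compact_open_topology)
  qed
  then show ?thesis
    unfolding geodesic_space_def cl by blast
qed

end

theory Submission
  imports Defs
begin

text \<open>
  Write \<open>X\<close> for the complement of the finite set \<open>Q\<close>. Evaluating an NGMPR at the end \<open>1\<close> of the
  deformation interval gives a motion planning rule, so it suffices to bound \<open>TC\<close> from below and
  \<open>GC\<close> from above; the partition used for \<open>GC\<close> serves for \<open>TC\<close> as well.

  \<^bold>\<open>Lower bound.\<close> A rule on \<open>E\<close> is the same thing as a homotopy in \<open>X\<close> between the two projections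
  \<open>fst\<close> and \<open>snd\<close> on \<open>E\<close>. A locally compact \<open>E\<close> is closed in an open set and \<open>X\<close> is an ANR, so the
  homotopy extends to an open neighbourhood of \<open>E\<close>. Two sets \<open>E0\<close>, \<open>E1\<close> with rules would therefore
  yield an open cover of \<open>X \<times> X\<close> by two such sets. Restrict the cover to the product of a small sphere
  about \<open>p \<in> Q\<close> with a small sphere about \<open>q \<in> Q\<close>, \<open>p \<noteq> q\<close>. Seen from \<open>p\<close>, the second factor lies
  in a small ball that misses \<open>p\<close>; hence on the first open set the direction from \<open>p\<close>, which is the first
  coordinate, is null-homotopic (lemma \<open>nullhomotopic_direction\<close>). Symmetrically, the second coordinate is
  null-homotopic on the second open set. This is impossible
  (lemma \<open>sphere_Times_not_Un_nullhomotopic\<close>): by homotopy extension, the identity of the product of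
  spheres would be homotopic to a map into the union of two slices, whereas every self-map of a
  product of spheres that is homotopic to the identity is onto (lemma \<open>homotopic_id_sphere_Times_surj\<close>).
  In cohomological terms this is the statement that the two zero-divisors coming from \<open>p\<close> and \<open>q\<close>
  have non-zero product; here it is reduced, by passing to the join of the two spheres, to the
  non-contractibility of a sphere.

  \<^bold>\<open>Upper bound.\<close> The geodesic from \<open>x0\<close> to \<open>x1\<close> is the straight segment. If it misses \<open>Q\<close> it can be
  kept. Otherwise it is bent into a parabola by adding \<open>s * t * (1 - t) * w\<close>, where the vector \<open>w\<close>
  depends only on the direction \<open>u\<close> of the segment. All that is needed is that a line of direction
  \<open>u\<close> through a point of \<open>Q\<close>, pushed by \<open>\<tau> * w u\<close> with \<open>0 < \<tau> < 1\<close>, misses \<open>Q\<close>; this holds for a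
  vector orthogonal to \<open>u\<close> that is shorter than the distances between distinct lines of direction \<open>u\<close>
  through points of \<open>Q\<close>. Such a \<open>w\<close> can be chosen continuously away from a finite set \<open>D\<close> of
  directions (lemma \<open>obtain_detour_field\<close>), namely the directions of lines through two points of \<open>Q\<close>
  and the two directions parallel to an auxiliary vector. On \<open>D\<close> itself continuity is automatic because
  \<open>D\<close> is discrete. So the three sets "segment misses \<open>Q\<close>", "segment meets \<open>Q\<close>, direction not in
  \<open>D\<close>" and "segment meets \<open>Q\<close>, direction in \<open>D\<close>" do the job.
\<close>

section \<open>The compact-open topology and currying\<close>

lemma openin_compact_open_subbasic:
  assumes "compactin K C" "openin Z V"
  shows "openin (compact_open_topology K Z)
           {f \<in> extensional (topspace K). continuous_map K Z f \<and> f ` C \<subseteq> V}"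
  unfolding compact_open_topology_def
  by (rule topology_generated_by_Basis) (use assms in blast)

text \<open>The tube lemma makes the preimages of the subbasic sets of the compact-open topology open.\<close>

lemma continuous_map_curry:
  assumes F: "continuous_map (prod_topology X K) Z (\<lambda>(x, t). F x t)"
  shows "continuous_map X (compact_open_topology K Z) (\<lambda>x. restrict (F x) (topspace K))"
proof -
  have slice: "continuous_map K Z (restrict (F x) (topspace K))" if "x \<in> topspace X" for x
    using continuous_map_o_Pair[OF F that] by (rule continuous_map_eq) auto
  have tube: "openin X {x \<in> topspace X. \<forall>t\<in>C. F x t \<in> V}" (is "openin X ?N")
    if C: "compactin K C" and V: "openin Z V" for C V
  proof (subst openin_subopen, intro ballI)
    fix x assume "x \<in> ?N"
    then have x: "x \<in> topspace X" and sub: "\<forall>t\<in>C. F x t \<in> V" by auto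
    let ?W = "{z \<in> topspace (prod_topology X K). (\<lambda>(x, t). F x t) z \<in> V}"
    have "openin (prod_topology X K) ?W"
      by (rule openin_continuous_map_preimage[OF F V])
    moreover have "{x} \<times> C \<subseteq> ?W"
      using x sub compactin_subset_topspace[OF C] by auto
    ultimately obtain U W where U: "openin X U" "x \<in> U" and W: "C \<subseteq> W" "U \<times> W \<subseteq> ?W"
      using tube_lemma_right[OF _ C x, of ?W] by blast
    have "U \<subseteq> ?N"
    proof (intro subsetI CollectI conjI ballI)
      fix y t assume y: "y \<in> U" and "t \<in> C"
      then have "(y, t) \<in> ?W" using W by blast
      then show "F y t \<in> V" by simp
    qed (use openin_subset[OF U(1)] in blast)
    with U show "\<exists>U. openin X U \<and> x \<in> U \<and> U \<subseteq> ?N"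
      by blast
  qed
  show ?thesis
    unfolding compact_open_topology_def
  proof (rule continuous_on_generated_topo)
    fix U assume "U \<in> {{f \<in> extensional (topspace K). continuous_map K Z f \<and> f ` C \<subseteq> V} |C V.
                          compactin K C \<and> openin Z V}"
    then obtain C V where C: "compactin K C" and V: "openin Z V"
      and U: "U = {f \<in> extensional (topspace K). continuous_map K Z f \<and> f ` C \<subseteq> V}" by blast
    have "restrict (F x) (topspace K) ` C = F x ` C" for x
      using compactin_subset_topspace[OF C] by (intro image_cong) auto
    then have "(\<lambda>x. restrict (F x) (topspace K)) -` U \<inter> topspace X = {x \<in> topspace X. \<forall>t\<in>C. F x t \<in> V}"
      using slice by (auto simp: U)
    then show "openin X ((\<lambda>x. restrict (F x) (topspace K)) -` U \<inter> topspace X)"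
      using tube[OF C V] by simp
  next
    show "(\<lambda>x. restrict (F x) (topspace K)) ` topspace X \<subseteq>
        \<Union> {{f \<in> extensional (topspace K). continuous_map K Z f \<and> f ` C \<subseteq> V} |C V. compactin K C \<and> openin Z V}"
      using slice topspace_compact_open_topology[of K Z]
      unfolding compact_open_topology_def topology_generated_by_topspace by auto
  qed
qed

text \<open>The evaluation map is continuous when \<open>K\<close> is locally compact: if \<open>g x t \<in> V\<close>, then \<open>g x\<close> maps a
  compact neighbourhood \<open>C\<close> of \<open>t\<close> into \<open>V\<close>, and so does \<open>g y\<close> for all \<open>y\<close> near \<open>x\<close>.\<close>

lemma continuous_map_uncurry:
  assumes K: "locally_compact_space K" "Hausdorff_space K"
    and g: "continuous_map X (compact_open_topology K Z) g"
  shows "continuous_map (prod_topology X K) Z (\<lambda>(x, t). g x t)"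
proof -
  have gx: "g x \<in> extensional (topspace K)" "continuous_map K Z (g x)" if "x \<in> topspace X" for x
    using continuous_map_funspace[OF g] that by (auto simp: topspace_compact_open_topology)
  have nbhd: "neighbourhood_base_of (compactin K) K"
    using K by (simp add: locally_compact_space_neighbourhood_base)
  have "openin (prod_topology X K) {z \<in> topspace (prod_topology X K). (\<lambda>(x, t). g x t) z \<in> V}"
    if V: "openin Z V" for V
  proof (subst openin_subopen, safe)
    fix x t assume xt: "(x, t) \<in> topspace (prod_topology X K)" and inV: "g x t \<in> V"
    then have x: "x \<in> topspace X" and t: "t \<in> topspace K" by auto
    have "openin K {s \<in> topspace K. g x s \<in> V}"
      by (rule openin_continuous_map_preimage[OF gx(2)[OF x] V])
    then obtain N C where N: "openin K N" "t \<in> N" "N \<subseteq> C" and C: "compactin K C"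
      and sub: "C \<subseteq> {s \<in> topspace K. g x s \<in> V}"
      using nbhd t inV unfolding neighbourhood_base_of by (elim allE[of _ "{s \<in> topspace K. g x s \<in> V}"] allE[of _ t]) auto
    define U where "U = {y \<in> topspace X. g y \<in> {f \<in> extensional (topspace K). continuous_map K Z f \<and> f ` C \<subseteq> V}}"
    have "openin X U"
      unfolding U_def by (rule openin_continuous_map_preimage[OF g openin_compact_open_subbasic[OF C V]])
    then have "openin (prod_topology X K) (U \<times> N)"
      using N by (simp add: openin_prod_Times_iff)
    moreover have "(x, t) \<in> U \<times> N"
      using x gx[OF x] sub N by (auto simp: U_def)
    moreover have "U \<times> N \<subseteq> {z \<in> topspace (prod_topology X K). (\<lambda>(x, t). g x t) z \<in> V}"
      using N openin_subset[OF N(1)] by (auto simp: U_def)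
    ultimately show "\<exists>T. openin (prod_topology X K) T \<and> (x, t) \<in> T \<and>
        T \<subseteq> {z \<in> topspace (prod_topology X K). (\<lambda>(x, t). g x t) z \<in> V}"
      by blast
  qed
  then show ?thesis
    using gx(2) by (auto simp: continuous_map_def Pi_iff)
qed

lemma continuous_map_eval:
  assumes "t \<in> topspace K"
  shows "continuous_map (compact_open_topology K Z) Z (\<lambda>f. f t)"
  unfolding continuous_map_def
proof (intro conjI allI impI)
  show "(\<lambda>f. f t) \<in> topspace (compact_open_topology K Z) \<rightarrow> topspace Z"
    using assms by (auto simp: topspace_compact_open_topology continuous_map_def)
  fix V assume "openin Z V"
  then have "openin (compact_open_topology K Z)
      {f \<in> extensional (topspace K). continuous_map K Z f \<and> f ` {t} \<subseteq> V}"
    using assms by (intro openin_compact_open_subbasic) auto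
  then show "openin (compact_open_topology K Z) {f \<in> topspace (compact_open_topology K Z). f t \<in> V}"
    by (simp add: topspace_compact_open_topology conj_assoc)
qed

lemma locally_compact_Hausdorff_unit_interval:
  "locally_compact_space unit_interval" "Hausdorff_space unit_interval"
proof -
  have "compact_space unit_interval"
    by (simp add: compact_space_subtopology)
  then show "locally_compact_space unit_interval"
    by (rule compact_imp_locally_compact_space)
qed (simp add: Hausdorff_space_subtopology)

text \<open>Through this equivalence, all continuity questions about path spaces below become continuity
  questions about functions of several real variables.\<close>

lemma continuous_map_path_space_iff:
  assumes "\<And>z. z \<in> E \<Longrightarrow> g z \<in> extensional {0..1}"
  shows "continuous_map (top_of_set E) (path_space (top_of_set Z)) g \<longleftrightarrow>
    continuous_on (E \<times> {0..1}) (\<lambda>(z, t). g z t) \<and> (\<lambda>(z, t). g z t) \<in> E \<times> {0..1} \<rightarrow> Z"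
    (is "?L = ?R")
proof -
  have prod: "prod_topology (top_of_set E) unit_interval = top_of_set (E \<times> {0..1})"
    by (simp flip: subtopology_Times euclidean_product_topology)
  have R: "?R \<longleftrightarrow> continuous_map (prod_topology (top_of_set E) unit_interval) (top_of_set Z) (\<lambda>(z, t). g z t)"
    by (simp only: prod continuous_map_subtopology_eu) 
  show ?thesis
  proof
    assume ?L then show ?R unfolding R path_space_def
      by (rule continuous_map_uncurry[OF locally_compact_Hausdorff_unit_interval])
  next
    assume ?R
    then have "continuous_map (top_of_set E) (path_space (top_of_set Z))
        (\<lambda>z. restrict (g z) (topspace unit_interval))"
      unfolding R path_space_def by (rule continuous_map_curry)
    then show ?L
      by (rule continuous_map_eq) (use assms in \<open>auto simp: extensional_restrict\<close>)
  qed
qed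

section \<open>Planning rules as homotopies between the projections\<close>

lemma homotopic_with_canon_iff_continuous_on:
  "homotopic_with_canon (\<lambda>_. True) S T f g \<longleftrightarrow>
     (\<exists>h. continuous_on ({0..1} \<times> S) h \<and> h \<in> {0..1::real} \<times> S \<rightarrow> T \<and>
          (\<forall>x\<in>S. h (0, x) = f x) \<and> (\<forall>x\<in>S. h (1, x) = g x))"
  by (subst homotopic_with)
     (auto simp flip: subtopology_Times euclidean_product_topology)

lemma motion_planning_rule_imp_homotopic:
  assumes E: "E \<subseteq> X \<times> X" and s: "motion_planning_rule (top_of_set X) E s"
  shows "homotopic_with_canon (\<lambda>_. True) E X fst snd"
proof -
  have cont: "continuous_map (top_of_set E) (path_space (top_of_set X)) s"
    and ends: "\<And>z. z \<in> E \<Longrightarrow> s z \<in> paths_between (top_of_set X) (fst z) (snd z)"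
    using s E by (auto simp: motion_planning_rule_def subtopology_subtopology Int_absorb1)
  have "continuous_on (E \<times> {0..1}) (\<lambda>x. s (fst x) (snd x)) \<and> (\<lambda>x. s (fst x) (snd x)) \<in> E \<times> {0..1} \<rightarrow> X"
    using cont ends
    by (subst (asm) continuous_map_path_space_iff)
       (auto simp: paths_between_def path_space_def topspace_compact_open_topology case_prod_unfold)
  then have joint: "continuous_on (E \<times> {0..1}) (\<lambda>x. s (fst x) (snd x))" "\<And>z t. z \<in> E \<Longrightarrow> t \<in> {0..1} \<Longrightarrow> s z t \<in> X"
    by (auto simp: Pi_iff)
  have "continuous_on ({0..1} \<times> E) (\<lambda>x. s (fst (snd x, fst x)) (snd (snd x, fst x)))"
    by (rule continuous_on_compose2[OF joint(1)]) (auto intro!: continuous_intros)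
  moreover have "(\<lambda>x. s (snd x) (fst x)) \<in> {0..1} \<times> E \<rightarrow> X"
    by (auto intro: joint(2))
  ultimately show ?thesis
    unfolding homotopic_with_canon_iff_continuous_on
    using ends by (intro exI[of _ "\<lambda>x. s (snd x) (fst x)"]) (auto simp: paths_between_def)
qed

text \<open>The deformation parameter \<open>1\<close> picks from each near-geodesic a path that lies in \<open>X\<close>, not just in
  its closure.\<close>

lemma NGMPR_imp_homotopic:
  assumes E: "E \<subseteq> X \<times> X" and "NGMPR X E \<Phi>"
  shows "homotopic_with_canon (\<lambda>_. True) E X fst snd"
proof (rule motion_planning_rule_imp_homotopic[OF E])
  define s where "s = (\<lambda>z. \<Phi> z 1)"
  have cont: "continuous_map (top_of_set E)
      (compact_open_topology unit_interval (path_space (top_of_set (closure X)))) \<Phi>"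
    and near: "\<And>z. z \<in> E \<Longrightarrow> near_geodesic X (fst z) (snd z) (\<Phi> z)"
    using assms by (auto simp: NGMPR_def subtopology_subtopology Int_absorb1)
  have ends: "s z \<in> paths_between (top_of_set X) (fst z) (snd z)" if "z \<in> E" for z
    using near[OF that] by (force simp: near_geodesic_def s_def)
  have ext: "s z \<in> extensional {0..1}" "s z \<in> {0..1} \<rightarrow> X" if "z \<in> E" for z
    using ends[OF that]
    by (auto simp: paths_between_def path_space_def topspace_compact_open_topology continuous_map_in_subtopology)
  have "continuous_map (top_of_set E) (path_space (top_of_set (closure X))) s"
    unfolding s_def by (rule continuous_map_compose[OF cont continuous_map_eval, unfolded comp_def]) simp
  then have "continuous_on (E \<times> {0..1}) (\<lambda>(z, t). s z t)"
    by (simp add: continuous_map_path_space_iff ext)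
  then have "continuous_map (top_of_set E) (path_space (top_of_set X)) s"
    using ext by (subst continuous_map_path_space_iff) (auto simp: Pi_iff)
  then show "motion_planning_rule (top_of_set X) E s"
    using ends E by (auto simp: motion_planning_rule_def subtopology_subtopology Int_absorb1)
qed

section \<open>Self-maps of a product of spheres\<close>

text \<open>A map that avoids \<open>e\<close> can be contracted to the constant \<open>- e\<close> along straight segments that miss
  the origin, so the sphere would be contractible.\<close>

lemma not_homotopic_to_map_avoiding_point:
  fixes f :: "'a::euclidean_space \<Rightarrow> 'a"
  assumes hom: "homotopic_with_canon (\<lambda>_. True) (sphere 0 1) (sphere 0 1) id f"
    and e: "norm e = 1"
  shows "e \<in> f ` sphere 0 1"
proof (rule ccontr)
  assume e_notin: "e \<notin> f ` sphere 0 1"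
  have contf: "continuous_on (sphere 0 1) f" and f: "f \<in> sphere 0 1 \<rightarrow> sphere 0 1"
    using homotopic_with_imp_continuous[OF hom] homotopic_with_imp_funspace2[OF hom] by auto
  have "homotopic_with_canon (\<lambda>_. True) (sphere 0 1) (- {0}) f (\<lambda>_. - e)"
  proof (rule homotopic_with_linear[OF contf])
    fix z :: 'a assume z: "z \<in> sphere 0 1"
    have "0 \<notin> closed_segment (f z) (- e)"
    proof
      assume "0 \<in> closed_segment (f z) (- e)"
      then obtain t where t: "0 \<le> t" "t \<le> 1" and "(1 - t) *\<^sub>R f z = t *\<^sub>R e"
        by (auto simp: closed_segment_def)
      moreover have "norm (f z) = 1"
        using f z by auto
      ultimately have "1 - t = t"
        using e norm_scaleR[of "1 - t" "f z"] by simp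
      with \<open>(1 - t) *\<^sub>R f z = t *\<^sub>R e\<close> have "f z = e"
        by auto
      with e_notin z show False by blast
    qed
    then show "closed_segment (f z) (- e) \<subseteq> - {0}" by blast
  qed auto
  moreover have "homotopic_with_canon (\<lambda>_. True) (sphere 0 1) (- {0}) id f"
    using hom by (rule homotopic_with_subset_right) auto
  ultimately have "homotopic_with_canon (\<lambda>_. True) (sphere 0 1) (- {0}) id (\<lambda>_. - e)"
    by (rule homotopic_with_trans[rotated])
  then have "homotopic_with_canon (\<lambda>_. True) (sphere 0 1) (sphere 0 1) (sgn \<circ> id) (sgn \<circ> (\<lambda>_. - e))"
    by (rule homotopic_with_compose_continuous_left) (auto intro!: continuous_intros simp: norm_sgn)
  then have "homotopic_with_canon (\<lambda>_. True) (sphere 0 1) (sphere 0 1) id (\<lambda>_::'a. sgn (- e))"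
    by (rule homotopic_with_eq) (auto simp: sgn_div_norm)
  then have "contractible (sphere (0::'a) 1)"
    unfolding contractible_def by blast
  then show False
    by (simp add: contractible_sphere)
qed

text \<open>The unit sphere of \<open>'a \<times> 'b\<close> is the join of the unit spheres of the factors: a point \<open>z\<close> has
  coordinates \<open>N z\<close> in the product and a join parameter given by the norms of its two components.
  Apply the homotopy \<open>H\<close> from the identity to \<open>h\<close> to \<open>N z\<close>, running it only up to time \<open>\<sigma> z\<close>, where
  \<open>\<sigma>\<close> is \<open>1\<close> in the middle of the join and vanishes near its two ends, at which \<open>N\<close> is not
  continuous. The result is a self-map \<open>\<Psi>\<close> of the sphere that is homotopic to the identity. If \<open>h\<close>
  omits \<open>(c, d)\<close>, then \<open>\<Psi>\<close> omits the point of the middle of the join with coordinates \<open>(c, d)\<close>,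
  which contradicts the previous lemma.\<close>

lemma homotopic_id_sphere_Times_surj:
  fixes h :: "'a::euclidean_space \<times> 'b::euclidean_space \<Rightarrow> 'a \<times> 'b"
  defines "T \<equiv> sphere 0 1 \<times> sphere 0 1"
  assumes "homotopic_with_canon (\<lambda>_. True) T T id h"
  shows "T \<subseteq> h ` T"
proof (rule subsetI, rule ccontr)
  fix cd assume cd: "cd \<in> T" and notin: "cd \<notin> h ` T"
  obtain H where contH: "continuous_on ({0..1} \<times> T) H" and HT: "H \<in> {0..1::real} \<times> T \<rightarrow> T"
    and H0: "\<And>z. z \<in> T \<Longrightarrow> H (0, z) = z" and H1: "\<And>z. z \<in> T \<Longrightarrow> H (1, z) = h z"
    using assms(2) by (auto simp: homotopic_with_canon_iff_continuous_on)
  define N :: "'a \<times> 'b \<Rightarrow> 'a \<times> 'b" where "N z = (sgn (fst z), sgn (snd z))" for z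
  define \<sigma> :: "'a \<times> 'b \<Rightarrow> real" where "\<sigma> z = max 0 (1 - 2 * \<bar>norm (fst z) - norm (snd z)\<bar>)" for z
  define \<Psi> where "\<Psi> = (\<lambda>(\<tau>, z). if fst z = 0 \<or> snd z = 0 then z else
     (norm (fst z) *\<^sub>R fst (H (\<tau> * \<sigma> z, N z)), norm (snd z) *\<^sub>R snd (H (\<tau> * \<sigma> z, N z))))"
  define S :: "('a \<times> 'b) set" where "S = sphere 0 1"
  have \<sigma>01: "\<sigma> z \<in> {0..1}" for z
    by (simp add: \<sigma>_def)
  have NT: "N z \<in> T" if "fst z \<noteq> 0" "snd z \<noteq> 0" for z
    using that by (simp add: N_def T_def norm_sgn)
  have HN: "norm (fst (H (\<tau> * \<sigma> z, N z))) = 1" "norm (snd (H (\<tau> * \<sigma> z, N z))) = 1"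
    if "\<tau> \<in> {0..1}" "fst z \<noteq> 0" "snd z \<noteq> 0" for \<tau> z
  proof -
    have "\<tau> * \<sigma> z \<in> {0..1}"
      using that(1) \<sigma>01[of z] by (auto simp: mult_le_one)
    then have "H (\<tau> * \<sigma> z, N z) \<in> T"
      using HT NT[OF that(2,3)] by blast
    then show "norm (fst (H (\<tau> * \<sigma> z, N z))) = 1" "norm (snd (H (\<tau> * \<sigma> z, N z))) = 1"
      by (auto simp: T_def)
  qed
  have norm_\<Psi>: "norm (fst (\<Psi> (\<tau>, z))) = norm (fst z)" "norm (snd (\<Psi> (\<tau>, z))) = norm (snd z)"
    if "\<tau> \<in> {0..1}" for \<tau> z
    using HN[OF that, of z] by (auto simp: \<Psi>_def)
  have \<Psi>_triv: "\<Psi> (\<tau>, z) = z" if "\<tau> * \<sigma> z = 0" for \<tau> z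
  proof (cases "fst z = 0 \<or> snd z = 0")
    case False
    then have "H (\<tau> * \<sigma> z, N z) = N z"
      using H0[OF NT[of z]] that by metis
    with False show ?thesis
      by (simp add: \<Psi>_def N_def sgn_div_norm)
  qed (auto simp: \<Psi>_def)
  have cont\<Psi>: "continuous_on ({0..1} \<times> S) \<Psi>"
  proof -
    let ?A = "({0..1::real} \<times> S) \<inter> {\<tau>z. fst (snd \<tau>z) \<noteq> 0 \<and> snd (snd \<tau>z) \<noteq> 0}"
    let ?B = "({0..1::real} \<times> S) \<inter> {\<tau>z. 1/2 < \<bar>norm (fst (snd \<tau>z)) - norm (snd (snd \<tau>z))\<bar>}"
    \<comment> \<open>On \<open>?B\<close>, near the ends of the join, the homotopy is stationary; this covers the points at which
      \<open>sgn\<close> is discontinuous.\<close>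
    have AB: "?A \<union> ?B = {0..1::real} \<times> S"
      by (auto simp: S_def norm_Pair1 norm_Pair2)
    have "open {\<tau>z :: real \<times> 'a \<times> 'b. fst (snd \<tau>z) \<noteq> 0 \<and> snd (snd \<tau>z) \<noteq> 0}"
      by (intro open_Collect_conj open_Collect_neq continuous_intros)
    then have A: "openin (top_of_set ({0..1::real} \<times> S)) ?A"
      by (rule openin_open_Int)
    have "open {\<tau>z :: real \<times> 'a \<times> 'b. 1/2 < \<bar>norm (fst (snd \<tau>z)) - norm (snd (snd \<tau>z))\<bar>}"
      by (intro open_Collect_less continuous_intros)
    then have B: "openin (top_of_set ({0..1::real} \<times> S)) ?B"
      by (rule openin_open_Int)
    have contA: "continuous_on ?A \<Psi>"
    proof -
      have "continuous_on ?A (\<lambda>x. H (fst x * \<sigma> (snd x), N (snd x)))"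
      proof (rule continuous_on_compose2[OF contH])
        show "continuous_on ?A (\<lambda>x. (fst x * \<sigma> (snd x), N (snd x)))"
          unfolding \<sigma>_def N_def by (intro continuous_intros) auto
        show "(\<lambda>x. (fst x * \<sigma> (snd x), N (snd x))) ` ?A \<subseteq> {0..1} \<times> T"
          using NT \<sigma>01 by (auto simp: mult_le_one)
      qed
      then have "continuous_on ?A (\<lambda>x. (norm (fst (snd x)) *\<^sub>R fst (H (fst x * \<sigma> (snd x), N (snd x))),
                    norm (snd (snd x)) *\<^sub>R snd (H (fst x * \<sigma> (snd x), N (snd x)))))"
        by (intro continuous_intros)
      then show ?thesis
        by (rule continuous_on_eq) (auto simp: \<Psi>_def)
    qed
    have "continuous_on ?B snd"
      by (intro continuous_intros)
    then have contB: "continuous_on ?B \<Psi>"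
    proof (rule continuous_on_eq)
      fix x assume "x \<in> ?B"
      then have "\<sigma> (snd x) = 0" by (simp add: \<sigma>_def)
      then show "snd x = \<Psi> x"
        using \<Psi>_triv[of "fst x" "snd x"] by simp
    qed
    show ?thesis
      using continuous_on_Un_local_open[of ?A ?B \<Psi>] A B contA contB unfolding AB by blast
  qed
  have "homotopic_with_canon (\<lambda>_. True) S S id (\<lambda>z. \<Psi> (1, z))"
    unfolding homotopic_with_canon_iff_continuous_on
  proof (intro exI[of _ \<Psi>] conjI ballI)
    show "\<Psi> \<in> {0..1} \<times> S \<rightarrow> S"
      using norm_\<Psi> by (auto simp: S_def norm_prod_def)
  qed (use cont\<Psi> \<Psi>_triv in auto)
  \<comment> \<open>The point in the middle of the join, where both components have equal norm.\<close>
  moreover define e where "e = (sqrt (1/2) *\<^sub>R fst cd, sqrt (1/2) *\<^sub>R snd cd)"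
  have "norm e = 1"
    using cd by (auto simp: e_def T_def norm_Pair power_mult_distrib)
  ultimately have "e \<in> (\<lambda>z. \<Psi> (1, z)) ` S"
    unfolding S_def by (rule not_homotopic_to_map_avoiding_point)
  then obtain z where z: "\<Psi> (1, z) = e"
    by auto
  have zn: "norm (fst z) = sqrt (1/2)" "norm (snd z) = sqrt (1/2)"
    using norm_\<Psi>[of 1 z] cd unfolding z by (auto simp: e_def T_def)
  then have nz: "fst z \<noteq> 0" "snd z \<noteq> 0" and "\<sigma> z = 1"
    by (auto simp: \<sigma>_def)
  then have "\<Psi> (1, z) = (sqrt (1/2) *\<^sub>R fst (h (N z)), sqrt (1/2) *\<^sub>R snd (h (N z)))"
    using zn by (simp add: \<Psi>_def H1[OF NT])
  with z have "h (N z) = cd"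
    by (simp add: e_def prod_eq_iff)
  with notin NT[OF nz] show False by auto
qed

text \<open>Shrink the cover to closed sets \<open>T - A'\<close> and \<open>T - B'\<close> that still cover the product \<open>T\<close>. By the
  homotopy extension property, \<open>fst\<close> is homotopic on all of \<open>T\<close> to a map \<open>f\<close> that is constantly \<open>c\<close>
  on the first of them, and \<open>snd\<close> to a map \<open>g\<close> that is constantly \<open>d\<close> on the second. Then \<open>(f, g)\<close> is
  homotopic to the identity of \<open>T\<close>, but it omits \<open>(- c, - d)\<close>.\<close>

lemma sphere_Times_not_Un_nullhomotopic:
  fixes A B :: "('a::euclidean_space \<times> 'b::euclidean_space) set"
  defines "T \<equiv> sphere 0 1 \<times> sphere 0 1"
  assumes AB: "openin (top_of_set T) A" "openin (top_of_set T) B" "A \<union> B = T"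
    and fst: "homotopic_with_canon (\<lambda>_. True) A (sphere 0 1) fst (\<lambda>_. c)" and c: "norm c = 1"
    and snd: "homotopic_with_canon (\<lambda>_. True) B (sphere 0 1) snd (\<lambda>_. d)" and d: "norm d = 1"
  shows False
proof -
  have "closedin (top_of_set T) (T - A)" "closedin (top_of_set T) (T - B)" "(T - A) \<inter> (T - B) = {}"
    using AB by auto
  then obtain A' B' where A'B': "openin (top_of_set T) A'" "openin (top_of_set T) B'"
    "T - A \<subseteq> A'" "T - B \<subseteq> B'" "A' \<inter> B' = {}"
    by (rule separation_normal_local)
  obtain f where f: "homotopic_with_canon (\<lambda>_. True) T (sphere 0 1) fst f" "\<And>z. z \<in> T - A' \<Longrightarrow> f z = c"
  proof (rule Borsuk_homotopy_extension_homotopic)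
    show "closedin (top_of_set T) (T - A')"
      by (rule closedin_diff) (use A'B' in auto)
    show "homotopic_with_canon (\<lambda>_. True) (T - A') (sphere 0 1) fst (\<lambda>_. c)"
      by (rule homotopic_with_subset_left[OF fst]) (use A'B' in blast)
  qed (auto simp: ANR_sphere T_def intro: continuous_intros that)
  obtain g where g: "homotopic_with_canon (\<lambda>_. True) T (sphere 0 1) snd g" "\<And>z. z \<in> T - B' \<Longrightarrow> g z = d"
  proof (rule Borsuk_homotopy_extension_homotopic)
    show "closedin (top_of_set T) (T - B')"
      by (rule closedin_diff) (use A'B' in auto)
    show "homotopic_with_canon (\<lambda>_. True) (T - B') (sphere 0 1) snd (\<lambda>_. d)"
      by (rule homotopic_with_subset_left[OF snd]) (use A'B' in blast)
  qed (auto simp: ANR_sphere T_def intro: continuous_intros that)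
  obtain F where F: "continuous_on ({0..1} \<times> T) F" "F \<in> {0..1::real} \<times> T \<rightarrow> sphere 0 1"
    "\<And>z. z \<in> T \<Longrightarrow> F (0, z) = fst z" "\<And>z. z \<in> T \<Longrightarrow> F (1, z) = f z"
    using f(1) by (auto simp: homotopic_with_canon_iff_continuous_on)
  obtain G where G: "continuous_on ({0..1} \<times> T) G" "G \<in> {0..1::real} \<times> T \<rightarrow> sphere 0 1"
    "\<And>z. z \<in> T \<Longrightarrow> G (0, z) = snd z" "\<And>z. z \<in> T \<Longrightarrow> G (1, z) = g z"
    using g(1) by (auto simp: homotopic_with_canon_iff_continuous_on)
  have "homotopic_with_canon (\<lambda>_. True) T T id (\<lambda>z. (f z, g z))"
    unfolding homotopic_with_canon_iff_continuous_on
  proof (intro exI[of _ "\<lambda>x. (F x, G x)"] conjI)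
    show "(\<lambda>x. (F x, G x)) \<in> {0..1} \<times> T \<rightarrow> T"
      using F(2) G(2) by (fastforce simp: T_def)
  qed (use F G in \<open>auto intro: continuous_intros\<close>)
  then have "T \<subseteq> (\<lambda>z. (f z, g z)) ` T"
    unfolding T_def by (rule homotopic_id_sphere_Times_surj)
  moreover have "(- c, - d) \<in> T"
    using c d by (simp add: T_def)
  ultimately obtain z where z: "z \<in> T" "f z = - c" "g z = - d"
    by auto
  have "c \<noteq> - c" "d \<noteq> - d"
    using c d by (auto simp: eq_neg_iff_add_eq_0 simp flip: scaleR_2)
  then show False
    using f(2)[of z] g(2)[of z] z A'B'(5) by auto
qed

section \<open>Two pieces do not suffice\<close>

text \<open>A locally compact subset of Euclidean space is closed in an open set, and homotopies of maps into
  an ANR extend from a closed set to a neighbourhood. This replaces the locally compact pieces of a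
  partition by an open cover.\<close>

lemma locally_compact_homotopic_neighbourhood:
  fixes f g :: "'a::euclidean_space \<Rightarrow> 'b::euclidean_space"
  assumes M: "open M" "E \<subseteq> M" and E: "locally_compact_space (top_of_set E)"
    and fg: "continuous_on M f" "f ` M \<subseteq> U" "continuous_on M g" "g ` M \<subseteq> U"
    and U: "open U" and hom: "homotopic_with_canon (\<lambda>_. True) E U f g"
  obtains O' where "open O'" "E \<subseteq> O'" "O' \<subseteq> M" "homotopic_with_canon (\<lambda>_. True) O' U f g"
proof -
  obtain C V where CV: "closed C" "open V" "E = C \<inter> V"
    using locally_compact_subspace_closed_Int_openin[of euclidean E] E by auto
  have V: "V \<inter> M \<subseteq> M" by blast
  have "closedin (top_of_set (V \<inter> M)) E"
    unfolding closedin_closed using CV M by (intro exI[of _ C]) blast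
  then obtain O' where "E \<subseteq> O'" "openin (top_of_set (V \<inter> M)) O'"
    "homotopic_with_canon (\<lambda>_. True) O' U f g"
    using homotopic_neighbourhood_extension[of "V \<inter> M" f U g E] fg hom open_imp_ANR[OF U]
      continuous_on_subset[OF _ V] by (metis (no_types, lifting) V image_mono order_trans)
  moreover from this have "open O'" "O' \<subseteq> M"
    using CV M openin_open_trans by (blast, metis Int_subset_iff openin_imp_subset)
  ultimately show thesis
    using that by blast
qed

text \<open>Viewed from the missing point \<open>p\<close>, the homotopy deforms the direction \<open>u\<close> into the direction
  towards a point of the small sphere about \<open>q\<close>. Since \<open>p\<close> is outside the ball about \<open>q\<close>, that point
  can be moved straight to \<open>q\<close> without meeting \<open>p\<close>.\<close>

lemma nullhomotopic_direction:
  fixes u v :: "'a::topological_space \<Rightarrow> 'b::euclidean_space"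
  assumes hom: "homotopic_with_canon (\<lambda>_. True) A X (\<lambda>z. p + \<epsilon> *\<^sub>R u z) (\<lambda>z. q + \<epsilon> *\<^sub>R v z)"
    and uv: "continuous_on A v" "\<And>z. z \<in> A \<Longrightarrow> norm (u z) = 1" "\<And>z. z \<in> A \<Longrightarrow> norm (v z) = 1"
    and p: "p \<notin> X" and \<epsilon>: "0 < \<epsilon>" "\<epsilon> < dist p q"
  shows "homotopic_with_canon (\<lambda>_. True) A (sphere 0 1) u (\<lambda>_. sgn (q - p))"
proof -
  have "homotopic_with_canon (\<lambda>_. True) A (- {0}) ((\<lambda>x. x - p) \<circ> (\<lambda>z. p + \<epsilon> *\<^sub>R u z))
          ((\<lambda>x. x - p) \<circ> (\<lambda>z. q + \<epsilon> *\<^sub>R v z))"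
    using hom by (rule homotopic_with_compose_continuous_left) (use p in \<open>auto intro!: continuous_intros\<close>)
  moreover have "homotopic_with_canon (\<lambda>_. True) A (- {0}) ((\<lambda>x. x - p) \<circ> (\<lambda>z. q + \<epsilon> *\<^sub>R v z)) (\<lambda>_. q - p)"
  proof (rule homotopic_with_linear)
    fix z assume z: "z \<in> A"
    have "closed_segment (q + \<epsilon> *\<^sub>R v z - p) (q - p) \<subseteq> cball (q - p) \<epsilon>"
      using \<epsilon> uv(3)[OF z] by (intro closed_segment_subset) (auto simp: dist_norm)
    also have "\<dots> \<subseteq> - {0}"
      using \<epsilon> by (auto simp: dist_norm norm_minus_commute)
    finally show "closed_segment (((\<lambda>x. x - p) \<circ> (\<lambda>z. q + \<epsilon> *\<^sub>R v z)) z) (q - p) \<subseteq> - {0}"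
      by simp
  qed (auto simp: comp_def intro!: continuous_intros uv)
  ultimately have "homotopic_with_canon (\<lambda>_. True) A (- {0}) ((\<lambda>x. x - p) \<circ> (\<lambda>z. p + \<epsilon> *\<^sub>R u z)) (\<lambda>_. q - p)"
    by (rule homotopic_with_trans)
  then have "homotopic_with_canon (\<lambda>_. True) A (sphere 0 1)
      (sgn \<circ> ((\<lambda>x. x - p) \<circ> (\<lambda>z. p + \<epsilon> *\<^sub>R u z))) (sgn \<circ> (\<lambda>_. q - p))"
    by (rule homotopic_with_compose_continuous_left) (auto intro!: continuous_intros simp: norm_sgn)
  then show ?thesis
    by (rule homotopic_with_eq) (use \<epsilon> uv in \<open>auto simp: sgn_div_norm\<close>)
qed

text \<open>The radius \<open>\<epsilon>\<close> is so small that the spheres about \<open>p\<close> and \<open>q\<close> miss \<open>Q\<close> and do not enclose each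
  other's centre. Then \<open>e\<close> embeds the product of unit spheres in \<open>X \<times> X\<close>, and the pieces pull back to
  a cover of that product as excluded above.\<close>

lemma square_not_Un_two_homotopic_pieces:
  fixes Q :: "'a::euclidean_space set"
  defines "X \<equiv> UNIV - Q"
  assumes Q: "finite Q" "p \<in> Q" "q \<in> Q" "p \<noteq> q"
    and cover: "E0 \<union> E1 = X \<times> X"
    and lc: "locally_compact_space (top_of_set E0)" "locally_compact_space (top_of_set E1)"
    and hom: "homotopic_with_canon (\<lambda>_. True) E0 X fst snd" "homotopic_with_canon (\<lambda>_. True) E1 X fst snd"
  shows False
proof -
  have X: "open X"
    using Q by (simp add: X_def finite_imp_closed open_Diff)
  obtain \<delta>p \<delta>q where \<delta>: "\<delta>p > 0" "\<And>x. x \<in> Q \<Longrightarrow> x \<noteq> p \<Longrightarrow> \<delta>p \<le> dist p x"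
    "\<delta>q > 0" "\<And>x. x \<in> Q \<Longrightarrow> x \<noteq> q \<Longrightarrow> \<delta>q \<le> dist q x"
    using finite_set_avoid[OF Q(1)] by metis
  define \<epsilon> where "\<epsilon> = min \<delta>p \<delta>q / 2"
  have \<epsilon>: "0 < \<epsilon>" "\<epsilon> < \<delta>p" "\<epsilon> < \<delta>q" "\<epsilon> < dist p q"
    using \<delta>(1,3) \<delta>(2)[of q] Q(3,4) by (auto simp: \<epsilon>_def min_def)
  define T :: "('a \<times> 'a) set" where "T = sphere 0 1 \<times> sphere 0 1"
  define e where "e = (\<lambda>z :: 'a \<times> 'a. (p + \<epsilon> *\<^sub>R fst z, q + \<epsilon> *\<^sub>R snd z))"
  have eT: "e ` T \<subseteq> X \<times> X"
  proof -
    have "r + \<epsilon> *\<^sub>R a \<in> X"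
      if "norm a = 1" "\<epsilon> < \<delta>" "\<And>x. x \<in> Q \<Longrightarrow> x \<noteq> r \<Longrightarrow> \<delta> \<le> dist r x" for r a \<delta>
    proof -
      have "dist r (r + \<epsilon> *\<^sub>R a) = \<epsilon>"
        using that(1) \<epsilon>(1) by (simp add: dist_norm)
      then show ?thesis
        using that(2) that(3)[of "r + \<epsilon> *\<^sub>R a"] \<epsilon>(1) by (cases "r + \<epsilon> *\<^sub>R a = r") (auto simp: X_def)
    qed
    from this[OF _ \<epsilon>(2) \<delta>(2)] this[OF _ \<epsilon>(3) \<delta>(4)]
    have "p + \<epsilon> *\<^sub>R a \<in> X" "q + \<epsilon> *\<^sub>R a \<in> X" if "norm a = 1" for a
      using that by blast+
    then show ?thesis by (auto simp: T_def e_def)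
  qed
  have conte: "continuous_on S e" for S
    unfolding e_def by (intro continuous_intros)
  \<comment> \<open>The part of the product of spheres that a neighbourhood of the piece \<open>E\<close> covers.\<close>
  have piece: "\<exists>A. openin (top_of_set T) A \<and> {z \<in> T. e z \<in> E} \<subseteq> A \<and>
      homotopic_with_canon (\<lambda>_. True) A X (\<lambda>z. p + \<epsilon> *\<^sub>R fst z) (\<lambda>z. q + \<epsilon> *\<^sub>R snd z)"
    if E: "E \<subseteq> X \<times> X" "locally_compact_space (top_of_set E)"
      "homotopic_with_canon (\<lambda>_. True) E X fst snd" for E
  proof -
    obtain O' where O': "open O'" "E \<subseteq> O'" "homotopic_with_canon (\<lambda>_. True) O' X fst snd"
      by (rule locally_compact_homotopic_neighbourhood[OF open_Times[OF X X] E(1,2) _ _ _ _ X E(3)])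
         (auto intro: continuous_intros)
    have "openin (top_of_set T) {z \<in> T. e z \<in> O'}"
      using continuous_openin_preimage_gen[OF conte O'(1), of T] by (simp add: vimage_def Int_def)
    moreover have "homotopic_with_canon (\<lambda>_. True) {z \<in> T. e z \<in> O'} X (fst \<circ> e) (snd \<circ> e)"
      using O'(3) by (rule homotopic_with_compose_continuous_right) (auto intro: conte)
    ultimately show ?thesis
      using O'(2) by (intro exI[of _ "{z \<in> T. e z \<in> O'}"]) (auto simp: e_def comp_def)
  qed
  have "E0 \<subseteq> X \<times> X" "E1 \<subseteq> X \<times> X" using cover by auto
  from piece[OF this(1) lc(1) hom(1)] obtain A where A: "openin (top_of_set T) A" "{z \<in> T. e z \<in> E0} \<subseteq> A"
      "homotopic_with_canon (\<lambda>_. True) A X (\<lambda>z. p + \<epsilon> *\<^sub>R fst z) (\<lambda>z. q + \<epsilon> *\<^sub>R snd z)"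
    by (elim exE conjE)
  from piece[OF \<open>E1 \<subseteq> X \<times> X\<close> lc(2) hom(2)] obtain B where B: "openin (top_of_set T) B" "{z \<in> T. e z \<in> E1} \<subseteq> B"
      "homotopic_with_canon (\<lambda>_. True) B X (\<lambda>z. p + \<epsilon> *\<^sub>R fst z) (\<lambda>z. q + \<epsilon> *\<^sub>R snd z)"
    by (elim exE conjE)
  have sub: "A \<subseteq> T" "B \<subseteq> T"
    using A(1) B(1) openin_imp_subset by auto
  show False
  proof (rule sphere_Times_not_Un_nullhomotopic[OF A(1)[unfolded T_def] B(1)[unfolded T_def]])
    show "A \<union> B = sphere 0 1 \<times> sphere 0 1"
      using A(2) B(2) sub eT cover by (fold T_def) blast
    show "homotopic_with_canon (\<lambda>_. True) A (sphere 0 1) fst (\<lambda>_. sgn (q - p))"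
      by (rule nullhomotopic_direction[OF A(3)])
         (use \<epsilon> Q sub in \<open>auto simp: X_def T_def intro: continuous_intros\<close>)
    show "homotopic_with_canon (\<lambda>_. True) B (sphere 0 1) snd (\<lambda>_. sgn (p - q))"
      by (rule nullhomotopic_direction[OF homotopic_with_symD[OF B(3)]])
         (use \<epsilon> Q sub in \<open>auto simp: X_def T_def dist_commute intro: continuous_intros\<close>)
  qed (use Q in \<open>auto simp: norm_sgn\<close>)
qed

lemma two_le_partition_complexity_Compl_finite:
  fixes Q :: "'a::euclidean_space set"
  defines "X \<equiv> UNIV - Q"
  assumes Q: "finite Q" "2 \<le> card Q"
    and R: "\<And>E. E \<subseteq> X \<times> X \<Longrightarrow> R E \<Longrightarrow> homotopic_with_canon (\<lambda>_. True) E X fst snd"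
  shows "2 \<le> partition_complexity (top_of_set X) R"
  unfolding partition_complexity_def
proof (rule INF_greatest, elim CollectE exE conjE)
  fix k and E :: "nat \<Rightarrow> ('a \<times> 'a) set"
  assume "(\<Union>i\<le>k. E i) = topspace (top_of_set X) \<times> topspace (top_of_set X)"
    and E: "\<forall>i\<le>k. locally_compact_space (subtopology (prod_topology (top_of_set X) (top_of_set X)) (E i)) \<and> R (E i)"
  then have cover: "(\<Union>i\<le>k. E i) = X \<times> X" by simp
  obtain p q where pq: "p \<in> Q" "q \<in> Q" "p \<noteq> q"
    using Q by (metis card_2_iff' card_le_Suc0_iff_eq not_less_eq_eq numeral_2_eq_2)
  have sub: "E i \<subseteq> X \<times> X" if "i \<le> k" for i
    using cover that by blast
  have lc: "locally_compact_space (top_of_set (E i))"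
    and hom: "homotopic_with_canon (\<lambda>_. True) (E i) X fst snd" if "i \<le> k" for i
    using E that sub[OF that] R by (auto simp: subtopology_subtopology Int_absorb1)
  have "\<not> k < 2"
  proof
    assume "k < 2"
    \<comment> \<open>For \<open>k = 0\<close> the two pieces coincide, which does no harm.\<close>
    then have "{..k} = {0, k}" by auto
    then have "E 0 \<union> E k = X \<times> X"
      using cover by auto
    then show False
      using square_not_Un_two_homotopic_pieces[OF Q(1) pq, of "E 0" "E k"] lc hom unfolding X_def by auto
  qed
  then show "2 \<le> enat k"
    by (simp add: numeral_eq_enat)
qed

section \<open>Bent segments as near-geodesics\<close>

lemma path_length_le_Lipschitz:
  assumes lip: "\<And>t t'. t \<in> {0..1} \<Longrightarrow> t' \<in> {0..1} \<Longrightarrow> dist (\<gamma> t) (\<gamma> t') \<le> L * \<bar>t - t'\<bar>" and "0 \<le> L"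
  shows "path_length \<gamma> \<le> ereal L"
  unfolding path_length_def
proof (rule SUP_least, clarify)
  fix m :: nat and t :: "nat \<Rightarrow> real"
  assume mono: "mono_on {..m} t" and t: "t ` {..m} \<subseteq> {0..1}"
  have "(\<Sum>i<m. dist (\<gamma> (t i)) (\<gamma> (t (Suc i)))) \<le> (\<Sum>i<m. L * (t (Suc i) - t i))"
  proof (rule sum_mono)
    fix i assume "i \<in> {..<m}"
    then have i: "i \<in> {..m}" "Suc i \<in> {..m}" by auto
    have "t i \<le> t (Suc i)"
      using i by (intro mono_onD[OF mono]) auto
    moreover have "t i \<in> {0..1}" "t (Suc i) \<in> {0..1}"
      using t i by blast+
    ultimately show "dist (\<gamma> (t i)) (\<gamma> (t (Suc i))) \<le> L * (t (Suc i) - t i)"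
      using lip[of "t i" "t (Suc i)"] by simp
  qed
  also have "\<dots> = L * (t m - t 0)"
    by (simp flip: sum_distrib_left add: sum_lessThan_telescope)
  also have "\<dots> \<le> L * 1"
  proof (rule mult_left_mono[OF _ \<open>0 \<le> L\<close>])
    have "t m \<in> {0..1}" "t 0 \<in> {0..1}"
      using t by blast+
    then show "t m - t 0 \<le> 1" by auto
  qed
  finally show "ereal (\<Sum>i<m. dist (\<gamma> (t i)) (\<gamma> (t (Suc i)))) \<le> ereal L"
    by simp
qed

lemma dist_endpoints_le_path_length: "ereal (dist (\<gamma> 0) (\<gamma> 1)) \<le> path_length \<gamma>"
  unfolding path_length_def
  by (rule SUP_upper2[of "(1, real)"]) (auto simp: mono_on_def le_Suc_eq)

text \<open>By strict convexity, equality in the triangle inequality determines \<open>\<gamma> t\<close>. Hence a geodesic in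
  \<open>X\<close>, if there is one, is the straight segment that every rule below uses anyway.\<close>

lemma is_geodesic_euclidean_eq:
  fixes x0 x1 :: "'a::{real_inner, complete_space}"
  assumes "is_geodesic Z x0 x1 \<gamma>" and t: "t \<in> {0..1}"
  shows "\<gamma> t = x0 + t *\<^sub>R (x1 - x0)"
proof -
  have ends: "\<gamma> 0 = x0" "\<gamma> 1 = x1"
    using assms(1) by (simp_all add: is_geodesic_def paths_between_def)
  have iso: "dist (\<gamma> r) (\<gamma> r') = \<bar>r - r'\<bar> * dist x0 x1" if "r \<in> {0..1}" "r' \<in> {0..1}" for r r'
    using assms(1) that unfolding is_geodesic_def by blast
  have d: "dist x0 (\<gamma> t) = t * dist x0 x1" "dist (\<gamma> t) x1 = (1 - t) * dist x0 x1"
    using iso[of 0 t] iso[of t 1] t by (simp_all add: ends)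
  then have "dist x0 x1 = dist x0 (\<gamma> t) + dist (\<gamma> t) x1"
    by (simp add: algebra_simps)
  then have "dist x0 (\<gamma> t) *\<^sub>R (\<gamma> t - x1) = dist (\<gamma> t) x1 *\<^sub>R (x0 - \<gamma> t)"
    by (simp only: dist_triangle_eq) (simp only: dist_norm)
  then have "dist x0 x1 *\<^sub>R (t *\<^sub>R (\<gamma> t - x1)) = dist x0 x1 *\<^sub>R ((1 - t) *\<^sub>R (x0 - \<gamma> t))"
    by (simp only: d scaleR_scaleR mult.commute)
  then have "x0 = x1 \<or> t *\<^sub>R (\<gamma> t - x1) = (1 - t) *\<^sub>R (x0 - \<gamma> t)"
    by (simp only: scaleR_cancel_left dist_eq_0_iff disj_commute)
  then show ?thesis
    using d(1) by (auto simp: algebra_simps)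
qed

text \<open>The segment between the components of \<open>z\<close>, bent into a parabola with amplitude proportional to
  the deformation parameter \<open>s\<close>.\<close>

definition bent_path :: "'a::real_vector \<Rightarrow> 'a \<times> 'a \<Rightarrow> real \<Rightarrow> real \<Rightarrow> 'a" where
  "bent_path w z s t = fst z + t *\<^sub>R (snd z - fst z) + (s * t * (1 - t)) *\<^sub>R w"

lemma bent_path_ends [simp]: "bent_path w z s 0 = fst z" "bent_path w z s 1 = snd z"
  by (auto simp: bent_path_def)

text \<open>The speed of the parabola is \<open>x1 - x0 + s * (1 - 2 * t) * w\<close>, and the scalar factor of \<open>w\<close> is at most
  \<open>s\<close>. This bounds its length by a quantity that tends to the length of the segment as \<open>s\<close> tends to
  \<open>0\<close>.\<close>

lemma bent_path_Lipschitz: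
  fixes w :: "'a::real_normed_vector"
  assumes t: "t \<in> {0..1}" "t' \<in> {0..1}" and "0 \<le> s"
  shows "dist (bent_path w z s t) (bent_path w z s t') \<le> (dist (fst z) (snd z) + s * norm w) * \<bar>t - t'\<bar>"
proof -
  have "bent_path w z s t - bent_path w z s t' = (t - t') *\<^sub>R (snd z - fst z + (s * (1 - t - t')) *\<^sub>R w)"
    by (simp add: bent_path_def algebra_simps)
  then have "dist (bent_path w z s t) (bent_path w z s t') =
      \<bar>t - t'\<bar> * norm (snd z - fst z + (s * (1 - t - t')) *\<^sub>R w)"
    by (simp add: dist_norm)
  also have "\<dots> \<le> \<bar>t - t'\<bar> * (dist (fst z) (snd z) + s * norm w)"
  proof (intro mult_left_mono order_trans[OF norm_triangle_ineq] add_mono)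
    have "\<bar>1 - t - t'\<bar> \<le> 1" using t by auto
    then have "\<bar>s * (1 - t - t')\<bar> \<le> s"
      using \<open>0 \<le> s\<close> by (simp add: abs_mult mult_left_le)
    then show "norm ((s * (1 - t - t')) *\<^sub>R w) \<le> s * norm w"
      by (simp add: mult_right_mono)
  qed (auto simp: dist_norm norm_minus_commute)
  finally show ?thesis by (simp add: mult.commute)
qed

lemma path_length_restrict: "path_length (restrict \<gamma> {0..1}) = path_length \<gamma>"
proof -
  have eq: "(\<Sum>i<m. dist (restrict \<gamma> {0..1} (t i)) (restrict \<gamma> {0..1} (t (Suc i)))) =
        (\<Sum>i<m. dist (\<gamma> (t i)) (\<gamma> (t (Suc i))))"
    if t: "t ` {..m} \<subseteq> {0..1}" for m and t :: "nat \<Rightarrow> real"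
  proof -
    have "t i \<in> {0..1}" "t (Suc i) \<in> {0..1}" if "i < m" for i
      using t that by (auto simp: image_subset_iff)
    then show ?thesis by simp
  qed
  show ?thesis
    unfolding path_length_def
    by (rule SUP_cong[OF refl]) (clarsimp simp: eq simp del: restrict_apply)
qed

lemma path_length_bent_path:
  fixes w :: "'a::real_normed_vector"
  assumes "s \<in> {0..1}"
  shows "ereal (dist (fst z) (snd z)) \<le> path_length (bent_path w z s)"
    and "path_length (bent_path w z s) \<le> ereal (dist (fst z) (snd z) + s * norm w)"
proof -
  show "ereal (dist (fst z) (snd z)) \<le> path_length (bent_path w z s)"
    using dist_endpoints_le_path_length[of "bent_path w z s"] by simp
  show "path_length (bent_path w z s) \<le> ereal (dist (fst z) (snd z) + s * norm w)"
    using assms by (intro path_length_le_Lipschitz bent_path_Lipschitz) auto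
qed

text \<open>A continuous choice of the bending vector \<open>w\<close> gives both kinds of rules: the parabolas are jointly
  continuous in all parameters, their lengths converge to the length of the segment, and at
  \<open>s = 0\<close> they are the unique geodesic of the ambient space.\<close>

lemma bent_path_imp_rules:
  fixes w :: "'a::euclidean_space \<times> 'a \<Rightarrow> 'a"
  assumes X: "closure X = UNIV" and E: "E \<subseteq> X \<times> X" and w: "continuous_on E w"
    and avoid: "\<And>z s t. z \<in> E \<Longrightarrow> s \<in> {0<..1} \<Longrightarrow> t \<in> {0..1} \<Longrightarrow> bent_path (w z) z s t \<in> X"
  shows "\<exists>\<Phi>. NGMPR X E \<Phi>" and "\<exists>s. motion_planning_rule (top_of_set X) E s"
proof -
  define P where "P z s = restrict (bent_path (w z) z s) {0..1}" for z s
  define \<Phi> where "\<Phi> z = restrict (P z) {0..1}" for z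
  have ext: "P z s \<in> extensional {0..1}" for z s
    by (simp add: P_def)
  have contP: "continuous_map (top_of_set S) (path_space (top_of_set Y)) (\<lambda>y. P (f y) (g y))"
    if "continuous_on S f" "continuous_on S g" "f ` S \<subseteq> E"
      "\<And>y t. y \<in> S \<Longrightarrow> t \<in> {0..1} \<Longrightarrow> bent_path (w (f y)) (f y) (g y) t \<in> Y"
    for S Y and f :: "'c::euclidean_space \<Rightarrow> _" and g
  proof (subst continuous_map_path_space_iff[OF ext], intro conjI)
    have "continuous_on (S \<times> {0..1}) (\<lambda>x. bent_path (w (f (fst x))) (f (fst x)) (g (fst x)) (snd x))"
      unfolding bent_path_def using that(1-3)
      by (intro continuous_intros continuous_on_compose2[OF w]
          continuous_on_compose2[OF that(1)] continuous_on_compose2[OF that(2)]) auto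
    then show "continuous_on (S \<times> {0..1}) (\<lambda>(y, t). P (f y) (g y) t)"
      by (rule continuous_on_eq) (auto simp: P_def)
  qed (use that(4) in \<open>auto simp: P_def\<close>)
  have path: "P z s \<in> paths_between (top_of_set Y) (fst z) (snd z)"
    if "z \<in> E" "\<And>t. t \<in> {0..1} \<Longrightarrow> bent_path (w z) z s t \<in> Y" for z s Y
  proof -
    have "P z s \<in> topspace (path_space (top_of_set Y))"
      using continuous_map_funspace[OF contP[of "{0::real}" "\<lambda>_. z" "\<lambda>_. s" Y]] that
      by auto
    then show ?thesis by (simp add: paths_between_def P_def)
  qed
  have line: "dist (bent_path v z 0 t) (bent_path v z 0 t') = \<bar>t - t'\<bar> * dist (fst z) (snd z)" for v :: 'a and z t t'
  proof -
    have "bent_path v z 0 t - bent_path v z 0 t' = (t - t') *\<^sub>R (snd z - fst z)"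
      by (simp add: bent_path_def algebra_simps)
    then show ?thesis by (simp add: dist_norm norm_minus_commute)
  qed
  have geo: "is_geodesic Y (fst z) (snd z) (\<Phi> z 0)"
    if "z \<in> E" "\<And>t. t \<in> {0..1} \<Longrightarrow> bent_path (w z) z 0 t \<in> Y" for z Y
    using path[OF that] line by (auto simp: is_geodesic_def \<Phi>_def P_def)
  have "near_geodesic X (fst z) (snd z) (\<Phi> z)" if z: "z \<in> E" for z
    unfolding near_geodesic_def X
  proof (intro conjI allI impI)
    have "continuous_map unit_interval (path_space (top_of_set UNIV)) (\<Phi> z)"
      by (rule continuous_map_eq[OF contP[of "{0..1}" "\<lambda>_. z" "\<lambda>s. s"]])
         (use z in \<open>auto simp: \<Phi>_def intro: continuous_intros\<close>)
    then show "continuous_map unit_interval (subtopology (path_space (top_of_set UNIV))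
                 (paths_between (top_of_set UNIV) (fst z) (snd z))) (\<Phi> z)"
      unfolding continuous_map_in_subtopology using path[OF z, of _ UNIV] by (auto simp: \<Phi>_def)
    show "is_geodesic UNIV (fst z) (snd z) (\<Phi> z 0)"
      by (rule geo[OF z]) auto
    show "\<Phi> z ` {0<..1} \<subseteq> paths_between (top_of_set X) (fst z) (snd z)"
      using path[OF z avoid[OF z]] by (auto simp: \<Phi>_def)
    fix s :: "nat \<Rightarrow> real" assume s: "\<forall>n. s n \<in> {0..1}" "s \<longlonglongrightarrow> 0"
    then have s01: "s n \<in> {0..1}" for n by blast
    have len: "path_length (\<Phi> z r) = path_length (bent_path (w z) z r)" if "r \<in> {0..1}" for r
      using that by (simp add: \<Phi>_def P_def path_length_restrict)
    have "(\<lambda>n. path_length (\<Phi> z (s n))) \<longlonglongrightarrow> ereal (dist (fst z) (snd z))"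
    proof (rule tendsto_sandwich)
      show "\<forall>\<^sub>F n in sequentially. ereal (dist (fst z) (snd z)) \<le> path_length (\<Phi> z (s n))"
        by (intro always_eventually allI) (simp only: len[OF s01] path_length_bent_path(1)[OF s01])
      show "\<forall>\<^sub>F n in sequentially. path_length (\<Phi> z (s n)) \<le> ereal (dist (fst z) (snd z) + s n * norm (w z))"
        by (intro always_eventually allI) (simp only: len[OF s01] path_length_bent_path(2)[OF s01])
      have "(\<lambda>n. dist (fst z) (snd z) + s n * norm (w z)) \<longlonglongrightarrow> dist (fst z) (snd z) + 0 * norm (w z)"
        by (intro tendsto_intros s)
      then show "(\<lambda>n. ereal (dist (fst z) (snd z) + s n * norm (w z))) \<longlonglongrightarrow> ereal (dist (fst z) (snd z))"
        by simp
    qed auto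
    moreover have "path_length (\<Phi> z 0) = ereal (dist (fst z) (snd z))"
      using path_length_bent_path[where s = 0 and z = z and w = "w z"] len[of 0] by (simp add: order_antisym)
    ultimately show "(\<lambda>n. path_length (\<Phi> z (s n))) \<longlonglongrightarrow> path_length (\<Phi> z 0)"
      by simp
  qed
  moreover have "is_geodesic X (fst z) (snd z) (\<Phi> z 0)" if z: "z \<in> E" and \<gamma>: "is_geodesic X (fst z) (snd z) \<gamma>" for z \<gamma>
  proof (rule geo[OF z])
    fix t :: real assume t: "t \<in> {0..1}"
    have "\<gamma> t \<in> X"
      using \<gamma> t by (auto simp: is_geodesic_def paths_between_def path_space_def
          topspace_compact_open_topology continuous_map_in_subtopology)
    then show "bent_path (w z) z 0 t \<in> X"
      using is_geodesic_euclidean_eq[OF \<gamma> t] by (simp add: bent_path_def)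
  qed
  moreover have "continuous_map (top_of_set E)
      (compact_open_topology unit_interval (path_space (top_of_set (closure X)))) \<Phi>"
  proof -
    have "continuous_map (top_of_set (E \<times> {0..1})) (path_space (top_of_set (closure X))) (\<lambda>x. P (fst x) (snd x))"
      by (rule contP) (auto simp: X intro: continuous_intros)
    then have "continuous_map (prod_topology (top_of_set E) unit_interval) (path_space (top_of_set (closure X)))
        (\<lambda>(z, s). P z s)"
      by (simp add: case_prod_unfold flip: subtopology_Times euclidean_product_topology)
    from continuous_map_curry[OF this] show ?thesis
      by (simp add: \<Phi>_def [abs_def])
  qed
  ultimately have "NGMPR X E \<Phi>"
    using E by (auto simp: NGMPR_def subtopology_subtopology Int_absorb1)
  then show "\<exists>\<Phi>. NGMPR X E \<Phi>" by blast
  have "continuous_map (top_of_set E) (path_space (top_of_set X)) (\<lambda>z. P z 1)"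
    by (rule contP) (auto intro: continuous_intros avoid)
  moreover have "P z 1 \<in> paths_between (top_of_set X) (fst z) (snd z)" if "z \<in> E" for z
    by (rule path) (use that avoid in auto)
  ultimately have "motion_planning_rule (top_of_set X) E (\<lambda>z. P z 1)"
    using E by (auto simp: motion_planning_rule_def subtopology_subtopology Int_absorb1)
  then show "\<exists>s. motion_planning_rule (top_of_set X) E s" by blast
qed

section \<open>Detour vectors depending on the direction\<close>

text \<open>For a unit vector \<open>u\<close>, this is the orthogonal projection to the hyperplane orthogonal to \<open>u\<close>.\<close>

definition perp :: "'a::real_inner \<Rightarrow> 'a \<Rightarrow> 'a" where
  "perp u e = e - (u \<bullet> e) *\<^sub>R u"

text \<open>For \<open>M\<close> the set of differences of points of \<open>Q\<close>, this is a positive lower bound for the distances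
  between distinct lines of direction \<open>u\<close> through points of \<open>Q\<close>. A product is used instead of a
  minimum because it is evidently continuous; the factors are cut off at \<open>1\<close> so that it does not
  exceed any of them.\<close>

definition clearance :: "'a::real_inner set \<Rightarrow> 'a \<Rightarrow> real" where
  "clearance M u = (\<Prod>e\<in>{e \<in> M. perp u e \<noteq> 0}. min 1 (norm (perp u e)))"

lemma norm_perp_le:
  assumes "norm u = 1"
  shows "norm (perp u e) \<le> norm e"
proof -
  have "u \<bullet> u = 1"
    using assms by (simp add: norm_eq_1)
  then have "perp u e \<bullet> perp u e = e \<bullet> e - (u \<bullet> e)\<^sup>2"
    by (simp add: perp_def inner_diff inner_commute power2_eq_square)
  then have "perp u e \<bullet> perp u e \<le> e \<bullet> e"
    by simp
  then show ?thesis
    by (simp add: norm_le)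
qed

lemma perp_eq_0_imp_sgn:
  assumes "norm u = 1" "perp u e = 0" "e \<noteq> 0"
  shows "u = sgn e \<or> u = - sgn e"
proof -
  define k where "k = u \<bullet> e"
  have "e = k *\<^sub>R u"
    using assms by (simp add: perp_def k_def)
  then have "sgn e = sgn k *\<^sub>R u" "k \<noteq> 0"
    using assms by (auto simp: sgn_scaleR sgn_div_norm)
  then show ?thesis
    by (cases "k > 0") auto
qed

lemma clearance_pos: "0 < clearance M u"
  unfolding clearance_def by (rule prod_pos) auto

lemma clearance_le:
  assumes "finite M" "e \<in> M" "perp u e \<noteq> 0"
  shows "clearance M u \<le> norm (perp u e)"
proof -
  let ?N = "{e \<in> M. perp u e \<noteq> 0}"
  have "clearance M u = min 1 (norm (perp u e)) * (\<Prod>e\<in>?N - {e}. min 1 (norm (perp u e)))"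
    unfolding clearance_def using assms by (intro prod.remove) auto
  also have "\<dots> \<le> min 1 (norm (perp u e)) * 1"
    by (intro mult_left_mono prod_le_1) auto
  finally show ?thesis by simp
qed

text \<open>The component orthogonal to \<open>u\<close> of the displayed vector is non-zero and shorter than that of any
  element of \<open>M\<close> not parallel to \<open>u\<close>.\<close>

lemma clearance_avoids:
  assumes M: "finite M" and u: "norm u = 1" and v: "u \<bullet> v = 0" "v \<noteq> 0" "norm v \<le> 1" and \<tau>: "0 < \<tau>" "\<tau> < 1"
  shows "r *\<^sub>R u + \<tau> *\<^sub>R clearance M u *\<^sub>R v \<notin> M"
proof
  let ?e = "r *\<^sub>R u + \<tau> *\<^sub>R clearance M u *\<^sub>R v"
  assume e: "?e \<in> M"
  have perp: "perp u ?e = \<tau> *\<^sub>R clearance M u *\<^sub>R v"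
    using u v(1) by (simp add: perp_def inner_add norm_eq_1)
  then have "clearance M u \<le> norm (perp u ?e)"
    using clearance_pos[of M u] v(2) \<tau> by (intro clearance_le[OF M e]) auto
  also have "\<dots> = \<tau> * clearance M u * norm v"
    unfolding perp using clearance_pos[of M u] \<tau> by simp
  also have "\<dots> \<le> \<tau> * clearance M u * 1"
    using clearance_pos[of M u] \<tau> v(3) by (intro mult_left_mono) auto
  also have "\<dots> < clearance M u"
    using clearance_pos[of M u] \<tau> by simp
  finally show False by simp
qed

text \<open>The factor for \<open>e\<close> is left out where \<open>e\<close> is parallel to \<open>u\<close>, so the index set of the product is
  constant, and the product continuous, as long as no non-zero \<open>e \<in> M\<close> becomes parallel to \<open>u\<close>.\<close>

lemma continuous_on_clearance:
  assumes "finite M" and S: "\<And>u e. u \<in> S \<Longrightarrow> e \<in> M \<Longrightarrow> e \<noteq> 0 \<Longrightarrow> perp u e \<noteq> 0"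
  shows "continuous_on S (clearance M)"
proof -
  have "continuous_on S (\<lambda>u. \<Prod>e\<in>M - {0}. min 1 (norm (perp u e)))"
    unfolding perp_def by (intro continuous_intros)
  then show ?thesis
  proof (rule continuous_on_eq)
    fix u assume "u \<in> S"
    then have "{e \<in> M. perp u e \<noteq> 0} = M - {0}"
      using S by (auto simp: perp_def)
    then show "(\<Prod>e\<in>M - {0}. min 1 (norm (perp u e))) = clearance M u"
      by (simp add: clearance_def)
  qed
qed

text \<open>Projecting a fixed unit vector \<open>u0\<close> orthogonally to \<open>u\<close> gives a tangent vector field on the sphere
  that vanishes only at \<open>u0\<close> and \<open>- u0\<close>; there it is replaced by an arbitrary orthogonal vector, which
  exists because the dimension is at least \<open>2\<close>. A field without zeros that is continuous on the whole
  sphere does not exist in odd dimensions, so exceptional directions are unavoidable there.\<close>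

lemma obtain_detour_field:
  fixes Q :: "'a::euclidean_space set"
  assumes dim: "2 \<le> DIM('a)" and Q: "finite Q"
  obtains D and w :: "'a \<Rightarrow> 'a" where "finite D" "continuous_on (sphere 0 1 - D) w"
    "\<And>u q q' r \<tau>. norm u = 1 \<Longrightarrow> q \<in> Q \<Longrightarrow> q' \<in> Q \<Longrightarrow> 0 < \<tau> \<Longrightarrow> \<tau> < 1 \<Longrightarrow> q + r *\<^sub>R u + \<tau> *\<^sub>R w u \<noteq> q'"
proof -
  obtain u0 :: 'a where u0: "norm u0 = 1"
    using vector_choose_size[of 1] by auto
  obtain v0 :: 'a where v0: "v0 \<noteq> 0" "u0 \<bullet> v0 = 0"
    using orthogonal_to_vector_exists[OF dim, of u0] by (auto simp: orthogonal_def)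
  define M where "M = (\<lambda>(q, q'). q' - q) ` (Q \<times> Q)"
  have M: "finite M"
    using Q by (simp add: M_def)
  \<comment> \<open>Besides \<open>u0\<close> and \<open>- u0\<close>, these are the directions of lines through two points of \<open>Q\<close> (and \<open>0\<close>,
    which is not on the sphere), where the clearance may jump.\<close>
  define D where "D = {u0, - u0} \<union> sgn ` M \<union> (\<lambda>e. - sgn e) ` M"
  define v where "v u = (if perp u u0 = 0 then sgn v0 else perp u u0)" for u
  define w where "w u = clearance M u *\<^sub>R v u" for u
  have parallel: "u = u0 \<or> u = - u0" if "norm u = 1" "perp u u0 = 0" for u
  proof -
    have "u0 \<noteq> 0" "sgn u0 = u0"
      using u0 by (auto simp: sgn_div_norm)
    then show ?thesis
      using perp_eq_0_imp_sgn[OF that] by simp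
  qed
  have "finite D"
    using M by (simp add: D_def)
  moreover have "continuous_on (sphere 0 1 - D) w"
  proof -
    have "continuous_on (sphere 0 1 - D) (\<lambda>u. perp u u0)"
      unfolding perp_def by (intro continuous_intros)
    then have "continuous_on (sphere 0 1 - D) v"
      by (rule continuous_on_eq) (use parallel in \<open>auto simp: v_def D_def\<close>)
    moreover have "continuous_on (sphere 0 1 - D) (clearance M)"
      by (rule continuous_on_clearance[OF M]) (use perp_eq_0_imp_sgn in \<open>auto simp: D_def\<close>)
    ultimately show ?thesis
      unfolding w_def by (intro continuous_intros)
  qed
  moreover have "q + r *\<^sub>R u + \<tau> *\<^sub>R w u \<noteq> q'"
    if u: "norm u = 1" and q: "q \<in> Q" "q' \<in> Q" and \<tau>: "0 < \<tau>" "\<tau> < 1" for u q q' r \<tau>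
  proof -
    have "u \<bullet> v u = 0" "v u \<noteq> 0" "norm (v u) \<le> 1"
      using u v0 parallel[OF u] norm_perp_le[OF u, of u0] u0
      by (auto simp: v_def norm_sgn sgn_div_norm perp_def inner_diff norm_eq_1)
    then have "r *\<^sub>R u + \<tau> *\<^sub>R w u \<notin> M"
      unfolding w_def by (rule clearance_avoids[OF M u _ _ _ \<tau>])
    then show ?thesis
      using q by (force simp: M_def)
  qed
  ultimately show thesis
    using that by blast
qed

section \<open>Three pieces suffice\<close>

lemma partition_complexity_le_2:
  assumes cover: "E0 \<union> E1 \<union> E2 = X \<times> X" and disj: "E0 \<inter> E1 = {}" "E0 \<inter> E2 = {}" "E1 \<inter> E2 = {}"
    and lc: "locally_compact_space (top_of_set E0)" "locally_compact_space (top_of_set E1)"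
      "locally_compact_space (top_of_set E2)"
    and R: "R E0" "R E1" "R E2"
  shows "partition_complexity (top_of_set X) R \<le> 2"
proof -
  define E where "E i = (if i = 0 then E0 else if i = Suc 0 then E1 else E2)" for i :: nat
  have sub: "E0 \<subseteq> X \<times> X" "E1 \<subseteq> X \<times> X" "E2 \<subseteq> X \<times> X"
    using cover by auto
  have "partition_complexity (top_of_set X) R \<le> enat 2"
    unfolding partition_complexity_def
  proof (rule INF_lower, rule CollectI, intro exI[of _ E] conjI)
    show "disjoint_family_on E {..2}"
      using disj by (auto simp: disjoint_family_on_def E_def)
    show "(\<Union>i\<le>2. E i) = topspace (top_of_set X) \<times> topspace (top_of_set X)"
      using cover by (auto simp: E_def numeral_2_eq_2 atMost_Suc)
    show "\<forall>i\<le>2. locally_compact_space (subtopology (prod_topology (top_of_set X) (top_of_set X)) (E i)) \<and> R (E i)"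
      using lc R sub by (auto simp: E_def subtopology_subtopology Int_absorb1)
  qed
  then show ?thesis
    by (simp add: numeral_eq_enat)
qed

text \<open>A point lies on a segment iff the triangle inequality for it and the end points is an equality, and
  this is a closed condition on the end points.\<close>

lemma closed_segments_meeting:
  fixes Q :: "'a::euclidean_space set"
  assumes "finite Q"
  shows "closed {z. closed_segment (fst z) (snd z) \<inter> Q \<noteq> {}}"
proof -
  have "{z. closed_segment (fst z) (snd z) \<inter> Q \<noteq> {}} =
      (\<Union>q\<in>Q. {z. dist (fst z) (snd z) = dist (fst z) q + dist q (snd z)})"
    by (auto simp flip: between_mem_segment simp: between)
  also have "closed \<dots>"
    using assms by (intro closed_UN ballI closed_Collect_eq continuous_intros) auto
  finally show ?thesis .
qed

text \<open>The segment lies on the line through a point \<open>q \<in> Q\<close> in its direction, so each inner point of the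
  parabola is reached from \<open>q\<close> by a translation along that line and a push by a multiple \<open>\<tau>\<close> of \<open>w\<close>
  with \<open>0 < \<tau> < 1\<close>.\<close>

lemma bent_path_in_Compl:
  fixes Q :: "'a::euclidean_space set"
  assumes z: "fst z \<notin> Q" "snd z \<notin> Q" and meet: "closed_segment (fst z) (snd z) \<inter> Q \<noteq> {}"
    and w: "\<And>q q' r \<tau>. q \<in> Q \<Longrightarrow> q' \<in> Q \<Longrightarrow> 0 < \<tau> \<Longrightarrow> \<tau> < 1 \<Longrightarrow>
              q + r *\<^sub>R sgn (snd z - fst z) + \<tau> *\<^sub>R w \<noteq> q'"
    and st: "s \<in> {0<..1}" "t \<in> {0..1}"
  shows "bent_path w z s t \<notin> Q"
proof (cases "t = 0 \<or> t = 1")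
  case False
  with st have t: "0 < t" "t < 1" by auto
  obtain q t0 where q: "q \<in> Q" "q = (1 - t0) *\<^sub>R fst z + t0 *\<^sub>R snd z"
    using meet by (auto simp: closed_segment_def)
  define r where "r = (t - t0) * norm (snd z - fst z)"
  have "r *\<^sub>R sgn (snd z - fst z) = (t - t0) *\<^sub>R (snd z - fst z)"
    by (cases "snd z = fst z") (auto simp: r_def sgn_div_norm)
  then have "bent_path w z s t = q + r *\<^sub>R sgn (snd z - fst z) + (s * t * (1 - t)) *\<^sub>R w"
    by (simp add: bent_path_def q(2) algebra_simps)
  moreover have "0 < s * t * (1 - t)"
    using st t by simp
  moreover have "s * t * (1 - t) < 1"
  proof -
    have "s * t \<le> 1" using st by (auto intro: mult_le_one)
    then have "s * t * (1 - t) \<le> 1 * (1 - t)" using t by (intro mult_right_mono) auto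
    also have "\<dots> < 1" using t by simp
    finally show ?thesis .
  qed
  ultimately show ?thesis
    using w[OF q(1)] by metis
qed (use z in auto)

text \<open>Segments that miss \<open>Q\<close> need no bending. On the closed set of segments that meet \<open>Q\<close>, the direction
  is continuous; the pairs with direction in the finite set \<open>D\<close> form a closed part, the others an open
  part, and the detour field is continuous in the direction on each of the two.\<close>

lemma partition_complexity_Compl_finite_le_2:
  fixes Q :: "'a::euclidean_space set"
  defines "X \<equiv> UNIV - Q"
  assumes dim: "2 \<le> DIM('a)" and Q: "finite Q"
    and R: "\<And>E w. E \<subseteq> X \<times> X \<Longrightarrow> continuous_on E w \<Longrightarrow>
        (\<And>z s t. z \<in> E \<Longrightarrow> s \<in> {0<..1} \<Longrightarrow> t \<in> {0..1} \<Longrightarrow> bent_path (w z) z s t \<in> X) \<Longrightarrow> R E"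
  shows "partition_complexity (top_of_set X) R \<le> 2"
proof -
  obtain D and w :: "'a \<Rightarrow> 'a" where D: "finite D" and w: "continuous_on (sphere 0 1 - D) w"
    and avoid: "\<And>u q q' r \<tau>. norm u = 1 \<Longrightarrow> q \<in> Q \<Longrightarrow> q' \<in> Q \<Longrightarrow> 0 < \<tau> \<Longrightarrow> \<tau> < 1 \<Longrightarrow>
                  q + r *\<^sub>R u + \<tau> *\<^sub>R w u \<noteq> q'"
    using obtain_detour_field[OF dim Q] by metis
  define H where "H = {z :: 'a \<times> 'a. closed_segment (fst z) (snd z) \<inter> Q \<noteq> {}}"
  define M where "M = (X \<times> X) \<inter> H"
  define dir where "dir z = sgn (snd z - fst z)" for z :: "'a \<times> 'a"
  have openX: "open (X \<times> X)"
    using Q by (simp add: X_def finite_imp_closed open_Diff open_Times)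
  have closedH: "closed H"
    unfolding H_def by (rule closed_segments_meeting[OF Q])
  have lcM: "locally_compact_space (top_of_set M)"
    using locally_compact_subspace_closed_Int_openin_eq[of euclidean M] openX closedH
    by (auto simp: M_def locally_compact_space_euclidean)
  have ne: "fst z \<noteq> snd z" if "z \<in> M" for z
    using that by (auto simp: M_def H_def X_def)
  have contdir: "continuous_on M dir"
    unfolding dir_def by (intro continuous_intros ballI) (metis ne right_minus_eq)
  have dir: "norm (dir z) = 1" if "z \<in> M" for z
    using ne[OF that] by (simp add: dir_def norm_sgn)
  define E1 where "E1 = {z \<in> M. dir z \<notin> D}"
  define E2 where "E2 = {z \<in> M. dir z \<in> D}"
  have bent: "bent_path (w (dir z)) z s t \<in> X" if "z \<in> M" "s \<in> {0<..1}" "t \<in> {0..1}" for z s t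
    using bent_path_in_Compl[of z Q "w (dir z)" s t] avoid[OF dir[OF that(1)]] that
    by (auto simp: M_def H_def X_def dir_def)
  show ?thesis
  proof (rule partition_complexity_le_2)
    show "(X \<times> X - H) \<union> E1 \<union> E2 = X \<times> X"
      by (auto simp: E1_def E2_def M_def)
    show "locally_compact_space (top_of_set (X \<times> X - H))"
      using locally_compact_space_open_subset[of euclidean "X \<times> X - H"] openX closedH
      by (simp add: open_Diff locally_compact_space_euclidean)
    have "openin (top_of_set M) E1"
    proof -
      have "openin (top_of_set M) (M \<inter> dir -` (- D))"
        using D by (intro continuous_openin_preimage_gen[OF contdir]) (simp add: finite_imp_closed open_Compl)
      then show ?thesis by (simp add: E1_def vimage_def Int_def)
    qed
    then have "locally_compact_space (subtopology (top_of_set M) E1)"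
      by (intro locally_compact_space_open_subset lcM) (simp add: Hausdorff_space_subtopology)
    then show "locally_compact_space (top_of_set E1)"
      by (simp add: subtopology_subtopology E1_def Int_absorb1)
    have "closedin (top_of_set M) E2"
    proof -
      have "closedin (top_of_set M) (M \<inter> dir -` D)"
        using D by (intro continuous_closedin_preimage[OF contdir]) (simp add: finite_imp_closed)
      then show ?thesis by (simp add: E2_def vimage_def Int_def)
    qed
    then have "locally_compact_space (subtopology (top_of_set M) E2)"
      by (intro locally_compact_space_closed_subset lcM)
    then show "locally_compact_space (top_of_set E2)"
      by (simp add: subtopology_subtopology E2_def Int_absorb1)
    show "R (X \<times> X - H)"
    proof (rule R[of _ "\<lambda>_. 0"])
      fix z :: "'a \<times> 'a" and s t :: real
      assume z: "z \<in> X \<times> X - H" and t: "t \<in> {0..1}"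
      then have "bent_path 0 z s t \<in> closed_segment (fst z) (snd z)"
        unfolding closed_segment_def
        by (intro CollectI exI[of _ t]) (auto simp: bent_path_def algebra_simps)
      with z show "bent_path 0 z s t \<in> X"
        by (auto simp: H_def X_def)
    qed auto
    show "R E1"
    proof (rule R[of _ "\<lambda>z. w (dir z)"])
      show "continuous_on E1 (\<lambda>z. w (dir z))"
        by (rule continuous_on_compose2[OF w continuous_on_subset[OF contdir]])
           (use dir in \<open>auto simp: E1_def\<close>)
    qed (use bent in \<open>auto simp: E1_def M_def\<close>)
    show "R E2"
    proof (rule R[of _ "\<lambda>z. w (dir z)"])
      show "continuous_on E2 (\<lambda>z. w (dir z))"
        by (rule continuous_on_compose2[OF continuous_on_finite[OF D] continuous_on_subset[OF contdir]])
           (auto simp: E2_def)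
    qed (use bent in \<open>auto simp: E2_def M_def\<close>)
  qed (auto simp: E1_def E2_def M_def)
qed

theorem theorem2p4:
  fixes Q :: "(real ^ 'n) set"
  assumes "CARD('n) \<ge> 2" and "finite Q" and "card Q \<ge> 2"
  shows "GC (UNIV - Q) = 2 \<and> TC (top_of_set (UNIV - Q)) = 2"
proof
  have closure: "closure (UNIV - Q) = UNIV"
    using empty_interior_finite[OF assms(2)] closure_complement[of Q] by (simp add: Compl_eq_Diff_UNIV)
  have dim: "2 \<le> DIM(real ^ 'n)"
    using assms(1) by simp
  show "GC (UNIV - Q) = 2"
    unfolding GC_def
  proof (rule antisym)
    show "partition_complexity (top_of_set (UNIV - Q)) (\<lambda>E. \<exists>\<Phi>. NGMPR (UNIV - Q) E \<Phi>) \<le> 2"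
      by (rule partition_complexity_Compl_finite_le_2[OF dim assms(2)]) (rule bent_path_imp_rules(1)[OF closure])
    show "2 \<le> partition_complexity (top_of_set (UNIV - Q)) (\<lambda>E. \<exists>\<Phi>. NGMPR (UNIV - Q) E \<Phi>)"
      by (rule two_le_partition_complexity_Compl_finite[OF assms(2,3)]) (auto intro: NGMPR_imp_homotopic)
  qed
  show "TC (top_of_set (UNIV - Q)) = 2"
    unfolding TC_def
  proof (rule antisym)
    show "partition_complexity (top_of_set (UNIV - Q)) (\<lambda>E. \<exists>s. motion_planning_rule (top_of_set (UNIV - Q)) E s) \<le> 2"
      by (rule partition_complexity_Compl_finite_le_2[OF dim assms(2)]) (rule bent_path_imp_rules(2)[OF closure])
    show "2 \<le> partition_complexity (top_of_set (UNIV - Q)) (\<lambda>E. \<exists>s. motion_planning_rule (top_of_set (UNIV - Q)) E s)"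
      by (rule two_le_partition_complexity_Compl_finite[OF assms(2,3)]) (auto intro: motion_planning_rule_imp_homotopic)
  qed
qed

end
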